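(* For every integer $n\ge 0$ let $\overline{O_n}$ be the $n$-sinnet of square knotting with generating polynomial $\overline{O_n}(x)$, and let $O_n(x)$ be the generating polynomial of the $n$-overhand knot $O_n$. Then $$\overline{O_n}(x)=\left(x^2+3x+3\right)\overline{O_{n-1}}(x)+O_{n-1}(x)\qquad (n\ge 1),$$ and $\overline{O_n}(x)$ is given by the closed form $$\overline{O_n}(x)=\left(x^2+4x+3\right)^n+\left(x^2-1\right)\left(x^2+3x+3\right)^n\qquad (n\ge 0).$$
   Context: A knot (diagram) means a shadow on the sphere $S^2$: a finite collection of closed curves whose only singularities are finitely many transverse double points, called crossings, with no over/under information, considered up to planar isotopy (several components and crossingless circles are allowed). The unknot $U$ is a single simple closed curve. Each crossing can be split in two ways: remove the crossing and reconnect the four ends in one of the two planar non-crossing ways that join adjacent ends (type $0$ and type $1$ splits). A state of a knot $K$ with $m$ crossings is one of the $2^m$ diagrams obtained by choosing a split at each crossing; it is a disjoint union of simple closed curves (circles), and $|S|$ denotes the number of circles of the state $S$. The generating polynomial of $K$ is $K(x)=\sum_S x^{|S|}$, summed over all $2^m$ states. Consider diagrams in a disc with four boundary ends NW, SW (left) and NE, SE (right); two such diagrams are put side by side by joining the NE and SE ends of the first to the NW and SW ends of the second. The overhand block consists of three crossings stacked vertically: the two upper ends of the top crossing are NW and NE, the two lower ends of each crossing are joined to the two upper ends of the next one below (left to left, right to right), and the two lower ends of the bottom crossing are SW and SE. Put $n$ overhand blocks side by side; for $n=0$ take two disjoint horizontal strands NW–NE and SW–SE. The $n$-overhand knot $O_n$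 is obtained from this diagram by joining, outside the disc and without crossings, NW to SW and NE to SE (so $O_0=U$ and $O_1$ is the trefoil shadow). The $n$-sinnet of square knotting $\overline{O_n}$, the closure of $O_n$, is obtained by instead joining, outside the disc by disjoint simple arcs, NW to NE and SW to SE ($\overline{O_0}$ is two disjoint circles). *)

theory Defs
  imports "HOL-Library.Multiset" "HOL-Computational_Algebra.Polynomial"
begin

datatype corner = NW | NE | SW | SE

text \<open>
  A shadow is encoded by finitely many marked points on its curves, the arcs between consecutive
  marked points, and its crossings.  A crossing is given by its four ends, which are marked points
  labelled by their position in the plane; the corners NW, NE, SE, SW are in cyclic order, so
  the opposite ends NW, SE (and NE, SW) lie on the same branch of the curve.  In a closed diagram
  every marked point is used exactly twice, by two arcs (a loop at a point counting for two) or by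
  an arc and a crossing end.  Crossingless circles are closed chains of arcs.  Arcs form a multiset
  because two marked points on a circle may be joined by two different arcs.
\<close>

record diagram =
  pts :: "nat set"
  arcs :: "(nat \<times> nat) multiset"
  crossings :: "(corner \<Rightarrow> nat) set"

definition split0 :: "(corner \<Rightarrow> nat) \<Rightarrow> (nat \<times> nat) multiset" where
  "split0 c = {#(c NW, c NE), (c SW, c SE)#}"

definition split1 :: "(corner \<Rightarrow> nat) \<Rightarrow> (nat \<times> nat) multiset" where
  "split1 c = {#(c NW, c SW), (c NE, c SE)#}"

text \<open>The state in which exactly the crossings in \<open>A\<close> receive the type 1 split.\<close>

definition state :: "diagram \<Rightarrow> (corner \<Rightarrow> nat) set \<Rightarrow> diagram" where
  "state K A =
    \<lparr>pts = pts K,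
     arcs = arcs K + (\<Sum>c\<in>crossings K. if c \<in> A then split1 c else split0 c),
     crossings = {}\<rparr>"

definition joined :: "diagram \<Rightarrow> (nat \<times> nat) set" where
  "joined S = {(p, q). p \<in> pts S \<and> q \<in> pts S \<and>
    (p, q) \<in> (set_mset (arcs S) \<union> (set_mset (arcs S))\<inverse>)\<^sup>*}"

text \<open>Only meaningful for crossingless diagrams, whose connected components are the circles.\<close>

definition circles :: "diagram \<Rightarrow> nat" where
  "circles S = card (pts S // joined S)"

abbreviation X :: "int poly" where
  "X \<equiv> [:0, 1:]"

definition generating_poly :: "diagram \<Rightarrow> int poly" where
  "generating_poly K = (\<Sum>A\<in>Pow (crossings K). X ^ circles (state K A))"

text \<open>
  A tangle is a diagram in a disc with four boundary ends.  Its ends are marked points that are used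
  only once inside the disc.
\<close>

record tangle = diagram +
  ends :: "corner \<Rightarrow> nat"

definition relabel :: "(nat \<Rightarrow> nat) \<Rightarrow> tangle \<Rightarrow> tangle" where
  "relabel f T =
    \<lparr>pts = f ` pts T,
     arcs = image_mset (map_prod f f) (arcs T),
     crossings = (\<lambda>c. f \<circ> c) ` crossings T,
     ends = f \<circ> ends T\<rparr>"

text \<open>The marked points of two tangles are made disjoint by mapping them to even and odd numbers.\<close>

definition beside :: "tangle \<Rightarrow> tangle \<Rightarrow> tangle" where
  "beside T T' =
    (let L = relabel (\<lambda>p. 2 * p) T; R = relabel (\<lambda>p. 2 * p + 1) T' in
      \<lparr>pts = pts L \<union> pts R,
       arcs = arcs L + arcs R + {#(ends L NE, ends R NW), (ends L SE, ends R SW)#},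
       crossings = crossings L \<union> crossings R,
       ends = case_corner (ends L NW) (ends R NE) (ends L SW) (ends R SE)\<rparr>)"

definition above :: "tangle \<Rightarrow> tangle \<Rightarrow> tangle" where
  "above T T' =
    (let U = relabel (\<lambda>p. 2 * p) T; D = relabel (\<lambda>p. 2 * p + 1) T' in
      \<lparr>pts = pts U \<union> pts D,
       arcs = arcs U + arcs D + {#(ends U SW, ends D NW), (ends U SE, ends D NE)#},
       crossings = crossings U \<union> crossings D,
       ends = case_corner (ends U NW) (ends U NE) (ends D SW) (ends D SE)\<rparr>)"

definition four_points :: "corner \<Rightarrow> nat" where
  "four_points = case_corner 0 1 2 3"

definition single_crossing :: tangle where
  "single_crossing =
    \<lparr>pts = range four_points, arcs = {#}, crossings = {four_points}, ends = four_points\<rparr>"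

definition horizontal_strands :: tangle where
  "horizontal_strands =
    \<lparr>pts = range four_points,
     arcs = {#(four_points NW, four_points NE), (four_points SW, four_points SE)#},
     crossings = {}, ends = four_points\<rparr>"

definition overhand_block :: tangle where
  "overhand_block = above single_crossing (above single_crossing single_crossing)"

fun overhand_row :: "nat \<Rightarrow> tangle" where
  "overhand_row 0 = horizontal_strands"
| "overhand_row (Suc 0) = overhand_block"
| "overhand_row (Suc (Suc n)) = beside (overhand_row (Suc n)) overhand_block"

definition overhand_knot :: "nat \<Rightarrow> diagram" where
  "overhand_knot n =
    (let T = overhand_row n in
      \<lparr>pts = pts T,
       arcs = arcs T + {#(ends T NW, ends T SW), (ends T NE, ends T SE)#},
       crossings = crossings T\<rparr>)"

definition sinnet :: "nat \<Rightarrow> diagram" where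
  "sinnet n =
    (let T = overhand_row n in
      \<lparr>pts = pts T,
       arcs = arcs T + {#(ends T NW, ends T NE), (ends T SW, ends T SE)#},
       crossings = crossings T\<rparr>)"

end

theory Submission
  imports Defs
begin

text \<open>
  Splitting every crossing of a tangle leaves some closed loops and two strands joining the four
  ends.  By planarity the strands are either two horizontal ones, NW--NE and SW--SE, or two vertical
  ones, NW--SW and NE--SE.  Hence the part of a diagram that lies in the disc influences the
  generating polynomial only through two polynomials \<open>h\<close> and \<open>v\<close>, in which \<open>x\<close> counts the loops of
  the states with horizontal and with vertical strands; in other words the tangle behaves like the
  formal combination \<open>h H + v V\<close> of the two crossingless tangles \<open>H\<close> and \<open>V\<close>.

  Placing tangles side by side is bilinear in these combinations.  \<open>H\<close> is a unit, and \<open>V\<close> beside \<open>V\<close>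
  is \<open>V\<close> with one additional loop, so
  \<open>(h H + v V) (h' H + v' V) = h h' H + (h v' + v h' + x v v') V\<close>
  (lemmas \<open>horizontal_part_beside\<close> and \<open>vertical_part_beside\<close>).  Exchanging the ends NE and SW turns
  vertical stacking into side-by-side composition and swaps \<open>H\<close> with \<open>V\<close>; thus stacking needs no
  separate analysis.  Stacking three crossings \<open>H + V\<close> gives \<open>a H + V\<close> with \<open>a = x^2 + 3 x + 3\<close> for the
  overhand block.  Since \<open>V\<close> acts on itself as multiplication by \<open>x\<close>, the row of \<open>n\<close> blocks is
  \<open>(a H + V)^n = a^n H + v V\<close> with \<open>x v = (x + a)^n - a^n\<close> (lemma \<open>overhand_row_parts\<close>).

  Joining NW to NE and SW to SE turns \<open>H\<close> into two circles and \<open>V\<close> into one; the sinnet therefore has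
  the polynomial \<open>x^2 h + x v\<close>, which is the closed form.  The other way of joining exchanges the
  roles of \<open>h\<close> and \<open>v\<close> and gives \<open>x (x + a)^n\<close> for the overhand knot, and the recurrence is an
  identity between these closed forms.

  Circles are counted as connected components of graphs.  All topological input reduces to the
  remark that a new edge lowers the number of components by one if it joins two components, and
  leaves it unchanged otherwise (lemmas \<open>pieces_insert_unlinked\<close> and \<open>pieces_insert_linked\<close>).
\<close>

section \<open>Connected components of finite graphs\<close>

definition linked :: "nat set \<Rightarrow> (nat \<times> nat) set \<Rightarrow> (nat \<times> nat) set" where
  "linked V E = {(p, q). p \<in> V \<and> q \<in> V \<and> (p, q) \<in> (E \<union> E\<inverse>)\<^sup>*}"

definition pieces :: "nat set \<Rightarrow> (nat \<times> nat) set \<Rightarrow> nat" where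
  "pieces V E = card (V // linked V E)"

lemma equiv_linked: "equiv V (linked V E)"
proof -
  have "sym ((E \<union> E\<inverse>)\<^sup>*)"
    by (intro sym_rtrancl sym_Un_converse)
  then show ?thesis
    unfolding equiv_def linked_def refl_on_def
    by (auto simp: sym_def trans_def intro: rtrancl_trans)
qed

lemma linked_refl: "p \<in> V \<Longrightarrow> (p, p) \<in> linked V E"
  by (simp add: linked_def)

lemma linked_sym: "(p, q) \<in> linked V E \<Longrightarrow> (q, p) \<in> linked V E"
  using equiv_linked by (meson equivE symD)

lemma linked_trans: "(p, q) \<in> linked V E \<Longrightarrow> (q, r) \<in> linked V E \<Longrightarrow> (p, r) \<in> linked V E"
  using equiv_linked by (meson equivE transD)

lemma linked_mem: "(p, q) \<in> linked V E \<Longrightarrow> p \<in> V \<and> q \<in> V"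
  by (simp add: linked_def)

lemma linked_empty: "(p, q) \<in> linked V {} \<longleftrightarrow> p \<in> V \<and> p = q"
  by (auto simp: linked_def)

lemma quotient_eq_image: "V // r = (\<lambda>x. r `` {x}) ` V"
  by (auto simp: quotient_def)

lemma pieces_empty: "pieces V {} = card V"
proof -
  have "V // linked V {} = (\<lambda>x. {x}) ` V"
    by (auto simp: quotient_def linked_def)
  then show ?thesis
    by (simp add: pieces_def card_image)
qed

text \<open>
  A path that uses the new edge can be shortened to one that uses it only once, in one of the two
  directions.
\<close>

lemma linked_insert:
  assumes "p \<in> V" "q \<in> V"
  shows "(x, y) \<in> linked V (insert (p, q) E) \<longleftrightarrow>
    (x, y) \<in> linked V E \<or>
    (x, p) \<in> linked V E \<and> (q, y) \<in> linked V E \<or>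
    (x, q) \<in> linked V E \<and> (p, y) \<in> linked V E"
proof -
  let ?r = "(E \<union> E\<inverse>)\<^sup>*"
  have e: "insert (p, q) E \<union> (insert (p, q) E)\<inverse> = insert (p, q) (insert (q, p) (E \<union> E\<inverse>))"
    by auto
  have s: "(a, b) \<in> ?r \<longleftrightarrow> (b, a) \<in> ?r" for a b
    using sym_rtrancl[OF sym_Un_converse] by (metis symD)
  have t: "(a, b) \<in> ?r \<Longrightarrow> (b, c) \<in> ?r \<Longrightarrow> (a, c) \<in> ?r" for a b c
    by (rule rtrancl_trans)
  have "(x, y) \<in> (insert (p, q) E \<union> (insert (p, q) E)\<inverse>)\<^sup>* \<longleftrightarrow>
     (x, y) \<in> ?r \<or> (x, p) \<in> ?r \<and> (q, y) \<in> ?r \<or> (x, q) \<in> ?r \<and> (p, y) \<in> ?r"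
    unfolding e rtrancl_insert by (auto dest: t s[THEN iffD1])
  then show ?thesis
    using assms by (auto simp: linked_def)
qed

lemma pieces_insert_linked:
  assumes "(p, q) \<in> linked V E"
  shows "pieces V (insert (p, q) E) = pieces V E"
proof -
  have "(x, y) \<in> linked V (insert (p, q) E) \<longleftrightarrow> (x, y) \<in> linked V E" for x y
    using assms linked_mem[OF assms] by (meson linked_insert linked_trans linked_sym)
  then have "linked V (insert (p, q) E) = linked V E"
    by auto
  then show ?thesis
    by (simp add: pieces_def)
qed

text \<open>
  The classes of \<open>p\<close> and \<open>q\<close> merge, and every other class survives unchanged.
\<close>

lemma pieces_insert_unlinked:
  assumes V: "finite V" "p \<in> V" "q \<in> V" and pq: "(p, q) \<notin> linked V E"
  shows "pieces V E = Suc (pieces V (insert (p, q) E))"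
proof -
  let ?L = "linked V E" and ?L' = "linked V (insert (p, q) E)"
  let ?P = "?L `` {p}" and ?Q = "?L `` {q}"
  let ?rest = "V // ?L - {?P, ?Q}"
  have PQ: "?P \<in> V // ?L" "?Q \<in> V // ?L" "?P \<noteq> ?Q"
    using V pq by (auto intro: quotientI simp: eq_equiv_class_iff[OF equiv_linked])
  have fin: "finite (V // ?L)"
    using V(1) by (simp add: quotient_def)
  have merged: "?L' `` {x} = ?P \<union> ?Q" if "x \<in> ?P \<union> ?Q" for x
  proof -
    have "(x, y) \<in> ?L' \<longleftrightarrow> (p, y) \<in> ?L \<or> (q, y) \<in> ?L" for y
      unfolding linked_insert[OF V(2,3)]
      using that by (blast dest: linked_sym linked_trans intro: linked_sym linked_trans)
    then show ?thesis
      by auto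
  qed
  have kept: "?L' `` {x} = ?L `` {x}" if "x \<in> V" "x \<notin> ?P \<union> ?Q" for x
    using that V by (auto simp: linked_insert intro: linked_sym)
  have in_merged: "?L `` {x} \<in> {?P, ?Q} \<longleftrightarrow> x \<in> ?P \<union> ?Q" if "x \<in> V" for x
    using that V by (auto simp: eq_equiv_class_iff[OF equiv_linked] intro: linked_sym)
  have "V // ?L' = insert (?P \<union> ?Q) ?rest"
  proof (intro equalityI subsetI)
    fix C assume "C \<in> V // ?L'"
    then obtain x where x: "x \<in> V" "C = ?L' `` {x}"
      by (auto elim: quotientE)
    show "C \<in> insert (?P \<union> ?Q) ?rest"
      using merged[of x] kept[of x] in_merged[of x] x quotientI[of x V ?L]
      by (cases "x \<in> ?P \<union> ?Q") auto
  next
    fix C assume C: "C \<in> insert (?P \<union> ?Q) ?rest"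
    show "C \<in> V // ?L'"
    proof (cases "C = ?P \<union> ?Q")
      case True
      then have "C = ?L' `` {p}"
        using merged[of p] V linked_refl by auto
      then show ?thesis
        using V by (simp add: quotientI)
    next
      case False
      then have "C \<in> V // ?L" and CPQ: "C \<notin> {?P, ?Q}"
        using C by auto
      then obtain x where x: "x \<in> V" "C = ?L `` {x}"
        unfolding quotient_def by blast
      then have "C = ?L' `` {x}"
        using kept[of x] in_merged[of x] CPQ by auto
      then show ?thesis
        using x by (simp add: quotientI)
    qed
  qed
  moreover have "?P \<union> ?Q \<notin> ?rest"
  proof
    assume *: "?P \<union> ?Q \<in> ?rest"
    then have "?P \<union> ?Q \<in> V // ?L"
      by blast
    then obtain x where x: "x \<in> V" "?P \<union> ?Q = ?L `` {x}"
      unfolding quotient_def by blast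
    have "p \<in> ?L `` {x}"
      using x(2) V linked_refl by blast
    then have "?L `` {x} = ?P"
      using equiv_linked by (metis Image_singleton_iff equiv_class_eq)
    with * x show False
      by auto
  qed
  moreover have "card (V // ?L) = Suc (Suc (card ?rest))"
  proof -
    have "card (V // ?L) = Suc (card (V // ?L - {?P}))"
      using PQ fin by (simp only: card_Suc_Diff1)
    also have "card (V // ?L - {?P}) = Suc (card (V // ?L - {?P} - {?Q}))"
      using PQ fin by (intro card_Suc_Diff1[symmetric]) auto
    finally show ?thesis
      by (simp only: Diff_insert2[symmetric])
  qed
  ultimately show ?thesis
    using fin by (simp add: pieces_def)
qed

text \<open>
  No edge leaves \<open>V\<close> or \<open>W\<close>, so a path stays on the side on which it starts.
\<close>

lemma linked_disjoint_union:
  assumes "V \<inter> W = {}" "E \<subseteq> V \<times> V" "F \<subseteq> W \<times> W"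
  shows "linked (V \<union> W) (E \<union> F) = linked V E \<union> linked W F"
proof -
  have inV: "y \<in> V \<and> (x, y) \<in> (E \<union> E\<inverse>)\<^sup>*"
    if "(x, y) \<in> ((E \<union> F) \<union> (E \<union> F)\<inverse>)\<^sup>*" "x \<in> V" for x y
    using that
  proof (induction rule: rtrancl_induct)
    case (step y z)
    then have "(y, z) \<in> E \<union> E\<inverse>"
      using assms by auto
    with step assms(2) show ?case
      by (auto intro: rtrancl_into_rtrancl)
  qed auto
  have inW: "y \<in> W \<and> (x, y) \<in> (F \<union> F\<inverse>)\<^sup>*"
    if "(x, y) \<in> ((E \<union> F) \<union> (E \<union> F)\<inverse>)\<^sup>*" "x \<in> W" for x y
    using that
  proof (induction rule: rtrancl_induct)
    case (step y z)
    then have "(y, z) \<in> F \<union> F\<inverse>"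
      using assms by auto
    with step assms(3) show ?case
      by (auto intro: rtrancl_into_rtrancl)
  qed auto
  have mono: "(E \<union> E\<inverse>)\<^sup>* \<subseteq> ((E \<union> F) \<union> (E \<union> F)\<inverse>)\<^sup>*"
    "(F \<union> F\<inverse>)\<^sup>* \<subseteq> ((E \<union> F) \<union> (E \<union> F)\<inverse>)\<^sup>*"
    by (auto intro!: rtrancl_mono)
  show ?thesis
    unfolding linked_def using inV inW mono by blast
qed

lemma pieces_disjoint_union:
  assumes "finite V" "finite W" "V \<inter> W = {}" "E \<subseteq> V \<times> V" "F \<subseteq> W \<times> W"
  shows "pieces (V \<union> W) (E \<union> F) = pieces V E + pieces W F"
proof -
  let ?L = "linked (V \<union> W) (E \<union> F)"
  have L: "?L = linked V E \<union> linked W F"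
    by (rule linked_disjoint_union) fact+
  have "?L `` {x} = linked V E `` {x}" if "x \<in> V" for x
    using that assms(3) by (auto simp: L dest: linked_mem)
  moreover have "?L `` {x} = linked W F `` {x}" if "x \<in> W" for x
    using that assms(3) by (auto simp: L dest: linked_mem)
  ultimately have "(V \<union> W) // ?L = V // linked V E \<union> W // linked W F"
    unfolding quotient_eq_image image_Un by (intro arg_cong2[of _ _ _ _ "(\<union>)"] image_cong refl)
  moreover have "V // linked V E \<inter> W // linked W F = {}"
  proof -
    have "C \<subseteq> V" "C \<noteq> {}" if "C \<in> V // linked V E" for C
      using that by (auto simp: quotient_def linked_def)
    moreover have "C \<subseteq> W" if "C \<in> W // linked W F" for C
      using that by (auto simp: quotient_def linked_def)
    ultimately show ?thesis
      using assms(3) by (metis disjoint_iff subset_empty le_inf_iff)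
  qed
  moreover have "finite (V // linked V E)" "finite (W // linked W F)"
    using assms by (simp_all add: quotient_def)
  ultimately show ?thesis
    by (simp add: pieces_def card_Un_disjoint)
qed

lemma linked_image:
  assumes "inj f"
  shows "(f p, f q) \<in> linked (f ` V) (map_prod f f ` E) \<longleftrightarrow> (p, q) \<in> linked V E"
proof -
  have "(f p, f q) \<in> (map_prod f f ` E \<union> (map_prod f f ` E)\<inverse>)\<^sup>*" if "(p, q) \<in> (E \<union> E\<inverse>)\<^sup>*"
    using that
  proof (induction rule: rtrancl_induct)
    case (step y z)
    then have "(f y, f z) \<in> map_prod f f ` E \<union> (map_prod f f ` E)\<inverse>"
      by force
    with step.IH show ?case
      by (rule rtrancl_into_rtrancl)
  qed auto
  moreover have "\<exists>q. y = f q \<and> (p, q) \<in> (E \<union> E\<inverse>)\<^sup>*"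
    if "(f p, y) \<in> (map_prod f f ` E \<union> (map_prod f f ` E)\<inverse>)\<^sup>*" for y
    using that
  proof (induction rule: rtrancl_induct)
    case (step y z)
    then obtain q q' where "y = f q" "z = f q'" "(p, q) \<in> (E \<union> E\<inverse>)\<^sup>*" "(q, q') \<in> E \<union> E\<inverse>"
      by (auto simp: inj_eq[OF assms])
    then show ?case
      by (blast intro: rtrancl_into_rtrancl)
  qed auto
  ultimately show ?thesis
    using assms by (auto simp: linked_def inj_image_mem_iff dest: injD)
qed

lemma pieces_image:
  assumes "inj f"
  shows "pieces (f ` V) (map_prod f f ` E) = pieces V E"
proof -
  let ?L = "linked (f ` V) (map_prod f f ` E)"
  have "?L `` {f x} = f ` (linked V E `` {x})" for x
  proof -
    have "y \<in> f ` V" if "(f x, y) \<in> ?L" for y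
      using that linked_mem by blast
    then show ?thesis
      using linked_image[OF assms] by (fast intro: imageI)
  qed
  then have "f ` V // ?L = (`) f ` (V // linked V E)"
    by (auto simp: quotient_def)
  moreover have "inj_on ((`) f) (V // linked V E)"
    using assms by (auto simp: inj_on_def inj_image_eq_iff)
  ultimately show ?thesis
    by (simp add: pieces_def card_image)
qed

section \<open>States and the ways in which they join four ends\<close>

definition state_arcs :: "('a) diagram_scheme \<Rightarrow> (corner \<Rightarrow> nat) set \<Rightarrow> (nat \<times> nat) set" where
  "state_arcs K A = set_mset (arcs K) \<union>
    (\<Union>c\<in>crossings K. set_mset (if c \<in> A then split1 c else split0 c))"

text \<open>Multiplicities of arcs do not affect connectivity, so a state may be replaced by its graph.\<close>

lemma circles_state:
  assumes "finite (crossings K)"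
  shows "circles (state K A) = pieces (pts K) (state_arcs K A)"
proof -
  have "set_mset (arcs (state K A)) = state_arcs K A"
    using assms by (simp add: state_def state_arcs_def set_mset_sum)
  then show ?thesis
    by (simp add: circles_def pieces_def joined_def linked_def state_def)
qed

lemma UNIV_corner: "UNIV = {NW, NE, SW, SE}"
  using corner.exhaust by auto

lemma all_corner: "(\<forall>i. P i) \<longleftrightarrow> P NW \<and> P NE \<and> P SW \<and> P SE"
  by (metis corner.exhaust)

lemma ex_corner: "(\<exists>i. P i) \<longleftrightarrow> P NW \<or> P NE \<or> P SW \<or> P SE"
  by (metis corner.exhaust)

text \<open>
  The two strands are horizontal.  The relation between all four ends is recorded, including that
  the two strands are distinct, so that every question about links between ends can be answered by
  rewriting.
\<close>

definition paired :: "(nat \<times> nat) set \<Rightarrow> (corner \<Rightarrow> nat) \<Rightarrow> bool" where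
  "paired L e \<longleftrightarrow> (\<forall>i j. (e i, e j) \<in> L \<longleftrightarrow> (i \<in> {NW, NE} \<longleftrightarrow> j \<in> {NW, NE}))"

text \<open>
  Reflection in the diagonal through NW and SE; composing the end labels with it makes vertical
  strands horizontal.
\<close>

abbreviation transposed :: "corner \<Rightarrow> corner" where
  "transposed \<equiv> case_corner NW SW NE SE"

lemma transposed_transposed: "transposed (transposed i) = i"
  by (cases i) auto

lemma range_transposed: "range (e \<circ> transposed) = range e"
  by (auto simp: UNIV_corner)

lemma paired_transposed_iff:
  "paired L (e \<circ> transposed) \<longleftrightarrow>
    (\<forall>i j. (e i, e j) \<in> L \<longleftrightarrow> (i \<in> {NW, SW} \<longleftrightarrow> j \<in> {NW, SW}))"
  by (simp add: paired_def all_corner) blast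

lemma paired_strands:
  assumes "inj e"
  defines "E \<equiv> {(e NW, e NE), (e SW, e SE)}"
  shows "paired (linked (range e) E) e" "pieces (range e) E = 2"
proof -
  have neq: "e i = e j \<longleftrightarrow> i = j" for i j
    using assms(1) by (simp add: inj_eq)
  show "paired (linked (range e) E) e"
    by (simp add: E_def paired_def all_corner linked_insert linked_empty neq)
  have "card (range e) = 4"
    using assms(1) by (simp add: card_image UNIV_corner)
  moreover have "pieces (range e) {} = Suc (pieces (range e) {(e SW, e SE)})"
    by (rule pieces_insert_unlinked) (simp_all add: UNIV_corner linked_empty neq)
  moreover have "pieces (range e) {(e SW, e SE)} = Suc (pieces (range e) E)"
    unfolding E_def
    by (rule pieces_insert_unlinked) (simp_all add: UNIV_corner linked_insert linked_empty neq)
  ultimately show "pieces (range e) E = 2"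
    by (simp add: pieces_empty)
qed

text \<open>
  The ends NW and SW lie on different strands.  The bound guarantees that subtracting these two
  strands from a component count never truncates.
\<close>

lemma paired_two_pieces:
  assumes "finite V" "range e \<subseteq> V" "paired (linked V E) e"
  shows "pieces V E \<ge> 2"
proof -
  let ?E = "insert (e NW, e SW) E"
  have "pieces V E = Suc (pieces V ?E)"
    using assms by (intro pieces_insert_unlinked) (auto simp: paired_def)
  moreover have "V // linked V ?E \<noteq> {}"
    using assms(2) by (auto simp: quotient_def)
  then have "pieces V ?E \<noteq> 0"
    using assms(1) by (simp add: pieces_def quotient_def)
  ultimately show ?thesis
    by simp
qed

text \<open>
  The heart of the composition law, for two crossingless diagrams \<open>(V, E)\<close> and \<open>(W, F)\<close> placed side
  by side.  The arc at the bottom always connects the two diagrams and costs one component.  The arc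
  at the top costs another one, unless both diagrams have vertical strands: then its two ends are
  already linked through NE--SE, the bottom arc and SW--NW, and it closes a loop.
\<close>

lemma glue:
  fixes e e' :: "corner \<Rightarrow> nat"
  assumes fin: "finite V" "finite W" and disj: "V \<inter> W = {}"
    and E: "E \<subseteq> V \<times> V" and F: "F \<subseteq> W \<times> W"
    and ends: "range e \<subseteq> V" "range e' \<subseteq> W"
    and e: "paired (linked V E) (e \<circ> transposed) \<longleftrightarrow> \<not> paired (linked V E) e"
    and e': "paired (linked W F) (e' \<circ> transposed) \<longleftrightarrow> \<not> paired (linked W F) e'"
  defines "U \<equiv> V \<union> W"
    and "G \<equiv> insert (e NE, e' NW) (insert (e SE, e' SW) (E \<union> F))"
    and "g \<equiv> case_corner (e NW) (e' NE) (e SW) (e' SE)"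
  shows "paired (linked U G) g \<longleftrightarrow> paired (linked V E) e \<and> paired (linked W F) e'"
    and "paired (linked U G) (g \<circ> transposed) \<longleftrightarrow>
      \<not> (paired (linked V E) e \<and> paired (linked W F) e')"
    and "pieces U G + 2 = pieces V E + pieces W F +
      (if paired (linked V E) e \<or> paired (linked W F) e' then 0 else 1)"
proof -
  let ?H = "insert (e SE, e' SW) (E \<union> F)"
  have in_ends: "e i \<in> V" "e' i \<in> W" for i
    using ends by auto
  have in_U: "e i \<in> U" "e' i \<in> U" for i
    using in_ends by (auto simp: U_def)
  have finU: "finite U"
    using fin by (simp add: U_def)
  have L: "linked U (E \<union> F) = linked V E \<union> linked W F"
    unfolding U_def by (rule linked_disjoint_union) fact+
  have cross: "(e i, e' j) \<notin> linked U (E \<union> F)" "(e' j, e i) \<notin> linked U (E \<union> F)"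
      "(e i, e j) \<in> linked U (E \<union> F) \<longleftrightarrow> (e i, e j) \<in> linked V E"
      "(e' i, e' j) \<in> linked U (E \<union> F) \<longleftrightarrow> (e' i, e' j) \<in> linked W F" for i j
    using in_ends disj by (auto simp: L dest: linked_mem)
  have first: "pieces V E + pieces W F = Suc (pieces U ?H)"
  proof -
    have "pieces V E + pieces W F = pieces U (E \<union> F)"
      unfolding U_def using pieces_disjoint_union[OF fin disj E F] by simp
    also have "\<dots> = Suc (pieces U ?H)"
      using cross in_U finU by (intro pieces_insert_unlinked)
    finally show ?thesis .
  qed
  have second: "pieces U G = (if (e NE, e' NW) \<in> linked U ?H then pieces U ?H else pieces U ?H - 1)"
    using pieces_insert_linked[of "e NE" "e' NW" U ?H]
      pieces_insert_unlinked[of U "e NE" "e' NW" ?H] in_U finU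
    by (simp add: G_def)
  have pos: "pieces U ?H \<ge> 1"
  proof -
    have "U // linked U ?H \<noteq> {}"
      using in_U by (auto simp: quotient_def)
    then show ?thesis
      using finU by (simp add: pieces_def quotient_def card_gt_0_iff Suc_le_eq)
  qed
  note vals = G_def g_def linked_insert in_U cross all_corner ex_corner
  have "(paired (linked U G) g \<longleftrightarrow> paired (linked V E) e \<and> paired (linked W F) e') \<and>
      (paired (linked U G) (g \<circ> transposed) \<longleftrightarrow>
        \<not> (paired (linked V E) e \<and> paired (linked W F) e')) \<and>
      ((e NE, e' NW) \<in> linked U ?H \<longleftrightarrow> \<not> (paired (linked V E) e \<or> paired (linked W F) e'))"
  proof (cases "paired (linked V E) e"; cases "paired (linked W F) e'")
    assume *: "paired (linked V E) e" "paired (linked W F) e'"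
    note ** = *[unfolded paired_def]
    show ?thesis
      by (simp add: * paired_transposed_iff) (simp add: paired_def ** vals)
  next
    assume *: "paired (linked V E) e" "\<not> paired (linked W F) e'"
    note ** = *(1)[unfolded paired_def] e'[THEN iffD2, OF *(2), unfolded paired_transposed_iff]
    show ?thesis
      by (simp add: * paired_transposed_iff) (simp add: paired_def ** vals)
  next
    assume *: "\<not> paired (linked V E) e" "paired (linked W F) e'"
    note ** = e[THEN iffD2, OF *(1), unfolded paired_transposed_iff] *(2)[unfolded paired_def]
    show ?thesis
      by (simp add: * paired_transposed_iff) (simp add: paired_def ** vals)
  next
    assume *: "\<not> paired (linked V E) e" "\<not> paired (linked W F) e'"
    note ** = e[THEN iffD2, OF *(1), unfolded paired_transposed_iff]
      e'[THEN iffD2, OF *(2), unfolded paired_transposed_iff]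
    show ?thesis
      by (simp add: * paired_transposed_iff) (simp add: paired_def ** vals)
  qed
  then show "paired (linked U G) g \<longleftrightarrow> paired (linked V E) e \<and> paired (linked W F) e'"
    and "paired (linked U G) (g \<circ> transposed) \<longleftrightarrow>
      \<not> (paired (linked V E) e \<and> paired (linked W F) e')"
    and "pieces U G + 2 = pieces V E + pieces W F +
      (if paired (linked V E) e \<or> paired (linked W F) e' then 0 else 1)"
    using first second pos by auto
qed

section \<open>The horizontal and the vertical polynomial of a tangle\<close>

text \<open>
  Only the labels of the ends are exchanged; the crossings keep their corners, so that a set of
  crossings denotes the same state before and after.
\<close>

definition flip :: "tangle \<Rightarrow> tangle" where
  "flip T = T\<lparr>ends := ends T \<circ> transposed\<rparr>"

lemma flip_flip: "flip (flip T) = T"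
  by (simp add: flip_def comp_def transposed_transposed)

lemma flip_simps [simp]:
  "pts (flip T) = pts T" "arcs (flip T) = arcs T" "crossings (flip T) = crossings T"
  "ends (flip T) = ends T \<circ> transposed" "state_arcs (flip T) A = state_arcs T A"
  by (simp_all add: flip_def state_arcs_def)

text \<open>Stacking joins SW to NW and SE to NE, which is what the exchange of NE and SW makes of beside.\<close>

lemma above_eq_beside: "above T T' = flip (beside (flip T) (flip T'))"
  by (simp add: above_def beside_def flip_def relabel_def Let_def fun_eq_iff split: corner.split)

definition horizontal :: "tangle \<Rightarrow> (corner \<Rightarrow> nat) set \<Rightarrow> bool" where
  "horizontal T A \<longleftrightarrow> paired (linked (pts T) (state_arcs T A)) (ends T)"

text \<open>The components of a state other than its two strands.\<close>

definition loops :: "tangle \<Rightarrow> (corner \<Rightarrow> nat) set \<Rightarrow> nat" where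
  "loops T A = pieces (pts T) (state_arcs T A) - 2"

definition horizontal_part :: "tangle \<Rightarrow> int poly" where
  "horizontal_part T = (\<Sum>A\<in>Pow (crossings T). if horizontal T A then X ^ loops T A else 0)"

abbreviation vertical_part :: "tangle \<Rightarrow> int poly" where
  "vertical_part T \<equiv> horizontal_part (flip T)"

text \<open>
  The last conjunct is the only trace of planarity: the strands of a state are never diagonal.  It
  is inherited under composition, so no geometry enters beyond the elementary tangles.
\<close>

definition well_formed :: "tangle \<Rightarrow> bool" where
  "well_formed T \<longleftrightarrow> finite (pts T) \<and> finite (crossings T) \<and> range (ends T) \<subseteq> pts T \<and>
    set_mset (arcs T) \<subseteq> pts T \<times> pts T \<and> (\<forall>c\<in>crossings T. range c \<subseteq> pts T) \<and>
    (\<forall>A\<subseteq>crossings T. horizontal (flip T) A \<longleftrightarrow> \<not> horizontal T A)"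

lemma loops_flip [simp]: "loops (flip T) A = loops T A"
  by (simp add: loops_def)

lemma well_formed_flip: "well_formed T \<Longrightarrow> well_formed (flip T)"
  by (auto simp: well_formed_def flip_flip range_transposed)

lemma vertical_part_eq:
  assumes "well_formed T"
  shows "vertical_part T = (\<Sum>A\<in>Pow (crossings T). if horizontal T A then 0 else X ^ loops T A)"
  unfolding horizontal_part_def using assms
  by (intro sum.cong) (auto simp: well_formed_def)

lemma state_arcs_mem:
  assumes "well_formed T"
  shows "state_arcs T A \<subseteq> pts T \<times> pts T"
proof -
  have "c i \<in> pts T" if "c \<in> crossings T" for c i
    using assms that unfolding well_formed_def by (meson range_subsetD)
  then show ?thesis
    using assms by (auto simp: state_arcs_def well_formed_def split0_def split1_def split: if_splits)
qed

lemma pieces_state: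
  assumes "well_formed T" "A \<subseteq> crossings T"
  shows "pieces (pts T) (state_arcs T A) = loops T A + 2"
proof -
  have "\<exists>e. range e \<subseteq> pts T \<and> paired (linked (pts T) (state_arcs T A)) e"
    using assms range_transposed[of "ends T"]
    unfolding well_formed_def horizontal_def by (metis flip_simps(1,4,5))
  then have "pieces (pts T) (state_arcs T A) \<ge> 2"
    using assms paired_two_pieces by (auto simp: well_formed_def)
  then show ?thesis
    by (simp add: loops_def)
qed

section \<open>Composition of tangles\<close>

lemma comp_eq_iff: "inj f \<Longrightarrow> f \<circ> c = f \<circ> d \<longleftrightarrow> c = d"
  by (auto simp: fun_eq_iff inj_eq)

lemma state_arcs_relabel:
  assumes "inj f"
  shows "state_arcs (relabel f T) ((\<circ>) f ` A) = map_prod f f ` state_arcs T A"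
proof -
  have "f \<circ> c \<in> (\<circ>) f ` A \<longleftrightarrow> c \<in> A" for c
    by (auto simp: image_iff comp_eq_iff[OF assms])
  then have "set_mset (if f \<circ> c \<in> (\<circ>) f ` A then split1 (f \<circ> c) else split0 (f \<circ> c)) =
      map_prod f f ` set_mset (if c \<in> A then split1 c else split0 c)" for c
    by (simp add: split0_def split1_def)
  then show ?thesis
    by (simp add: state_arcs_def relabel_def image_Un image_UN)
qed

text \<open>The state of two tangles side by side that has state \<open>A\<close> on the left and \<open>B\<close> on the right.\<close>

definition joint_state ::
  "(corner \<Rightarrow> nat) set \<Rightarrow> (corner \<Rightarrow> nat) set \<Rightarrow> (corner \<Rightarrow> nat) set" where
  "joint_state A B = (\<circ>) (\<lambda>p. 2 * p) ` A \<union> (\<circ>) (\<lambda>p. 2 * p + 1) ` B"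

lemma even_odd_crossing: "(\<lambda>p. 2 * p) \<circ> c \<noteq> (\<lambda>p. 2 * p + 1 :: nat) \<circ> (d :: corner \<Rightarrow> nat)"
proof
  assume "(\<lambda>p. 2 * p) \<circ> c = (\<lambda>p. 2 * p + 1) \<circ> d"
  then have "2 * c NW = 2 * d NW + 1"
    by (metis comp_apply)
  then show False
    by presburger
qed

lemma crossings_beside: "crossings (beside T T') = joint_state (crossings T) (crossings T')"
  by (simp add: beside_def joint_state_def relabel_def Let_def)

lemma inj_even_odd: "inj (\<lambda>p. 2 * p :: nat)" "inj (\<lambda>p. 2 * p + 1 :: nat)"
  by (auto intro: injI)

lemma mem_joint_state:
  "(\<lambda>p. 2 * p) \<circ> c \<in> joint_state A B \<longleftrightarrow> c \<in> A"
  "(\<lambda>p. 2 * p + 1) \<circ> c \<in> joint_state A B \<longleftrightarrow> c \<in> B"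
  unfolding joint_state_def Un_iff image_iff
  using comp_eq_iff[OF inj_even_odd(1)] comp_eq_iff[OF inj_even_odd(2)] even_odd_crossing
  by metis+

text \<open>
  A choice of splits for the composite is the same as a choice for each factor, because the two
  tangles have no crossing in common after relabelling.
\<close>

lemma bij_betw_joint_state:
  "bij_betw (\<lambda>(A, B). joint_state A B) (Pow P \<times> Pow Q) (Pow (joint_state P Q))"
proof -
  let ?left = "\<lambda>C. {c. (\<lambda>p. 2 * p) \<circ> c \<in> C}" and ?right = "\<lambda>C. {c. (\<lambda>p. 2 * p + 1) \<circ> c \<in> C}"
  have mono: "joint_state A B \<in> Pow (joint_state P Q)" if "A \<subseteq> P" "B \<subseteq> Q" for A B
    using that by (auto simp: joint_state_def)
  have split: "joint_state (?left C) (?right C) = C" if "C \<subseteq> joint_state P Q" for C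
    using that by (auto simp: joint_state_def)
  have "?left C \<subseteq> P" "?right C \<subseteq> Q" if "C \<subseteq> joint_state P Q" for C
    using that mem_joint_state by blast+
  moreover have "?left (joint_state A B) = A" "?right (joint_state A B) = B" for A B
    by (simp_all only: mem_joint_state Collect_mem_eq)
  ultimately show ?thesis
    using mono split
    by (intro bij_betw_byWitness[where f' = "\<lambda>C. (?left C, ?right C)"])
      (simp_all add: image_subset_iff del: One_nat_def)
qed

lemma state_arcs_beside:
  "state_arcs (beside T T') (joint_state A B) =
    insert (2 * ends T NE, 2 * ends T' NW + 1) (insert (2 * ends T SE, 2 * ends T' SW + 1)
      (map_prod (\<lambda>p. 2 * p) (\<lambda>p. 2 * p) ` state_arcs T A \<union>
       map_prod (\<lambda>p. 2 * p + 1) (\<lambda>p. 2 * p + 1) ` state_arcs T' B))"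
proof -
  let ?l = "\<lambda>p. 2 * p :: nat" and ?r = "\<lambda>p. 2 * p + 1 :: nat"
  let ?s = "\<lambda>C c. set_mset (if c \<in> C then split1 c else split0 c)"
  have "(\<Union>c\<in>(\<circ>) ?l ` P. ?s (joint_state A B) c) = (\<Union>c\<in>(\<circ>) ?l ` P. ?s ((\<circ>) ?l ` A) c)" for P
    using mem_joint_state(1)[of _ A B] mem_joint_state(1)[of _ A "{}"]
    by (simp add: joint_state_def)
  moreover have "(\<Union>c\<in>(\<circ>) ?r ` P. ?s (joint_state A B) c) = (\<Union>c\<in>(\<circ>) ?r ` P. ?s ((\<circ>) ?r ` B) c)" for P
    using mem_joint_state(2)[of _ A B] mem_joint_state(2)[of _ "{}" B]
    by (simp add: joint_state_def)
  ultimately have "state_arcs (beside T T') (joint_state A B) =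
    insert (2 * ends T NE, 2 * ends T' NW + 1) (insert (2 * ends T SE, 2 * ends T' SW + 1)
      (state_arcs (relabel ?l T) ((\<circ>) ?l ` A) \<union> state_arcs (relabel ?r T') ((\<circ>) ?r ` B)))"
    unfolding state_arcs_def beside_def Let_def
    by (simp add: relabel_def UN_Un Un_ac)
  then show ?thesis
    by (simp only: state_arcs_relabel[OF inj_even_odd(1)] state_arcs_relabel[OF inj_even_odd(2)])
qed

lemma paired_image:
  assumes "inj f"
  shows "paired (linked (f ` V) (map_prod f f ` E)) (f \<circ> e) \<longleftrightarrow> paired (linked V E) e"
  by (simp add: paired_def linked_image[OF assms])

text \<open>
  The case distinction of the gluing lemma, transported along the relabelling of the marked points.
\<close>

lemma beside_state:
  assumes T: "well_formed T" "A \<subseteq> crossings T" and T': "well_formed T'" "B \<subseteq> crossings T'"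
  shows "horizontal (beside T T') (joint_state A B) \<longleftrightarrow> horizontal T A \<and> horizontal T' B"
    and "horizontal (flip (beside T T')) (joint_state A B) \<longleftrightarrow>
      \<not> (horizontal T A \<and> horizontal T' B)"
    and "loops (beside T T') (joint_state A B) =
      loops T A + loops T' B + (if horizontal T A \<or> horizontal T' B then 0 else 1)"
proof -
  let ?l = "\<lambda>p. 2 * p :: nat" and ?r = "\<lambda>p. 2 * p + 1 :: nat"
  let ?V = "?l ` pts T" and ?W = "?r ` pts T'"
  let ?E = "map_prod ?l ?l ` state_arcs T A" and ?F = "map_prod ?r ?r ` state_arcs T' B"
  have L: "paired (linked ?V ?E) (?l \<circ> e) \<longleftrightarrow> paired (linked (pts T) (state_arcs T A)) e"
    and R: "paired (linked ?W ?F) (?r \<circ> e) \<longleftrightarrow> paired (linked (pts T') (state_arcs T' B)) e" for e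
    by (rule paired_image[OF inj_even_odd(1)] paired_image[OF inj_even_odd(2)])+
  have disj: "?V \<inter> ?W = {}"
    by (auto, presburger)
  have fin: "finite ?V" "finite ?W"
    using T T' by (auto simp: well_formed_def)
  have E: "?E \<subseteq> ?V \<times> ?V" and F: "?F \<subseteq> ?W \<times> ?W"
    using image_mono[OF state_arcs_mem[OF T(1), of A], of "map_prod ?l ?l"]
      image_mono[OF state_arcs_mem[OF T'(1), of B], of "map_prod ?r ?r"]
    by (simp_all only: map_prod_surj_on[OF refl refl])
  have ends: "range (?l \<circ> ends T) \<subseteq> ?V" "range (?r \<circ> ends T') \<subseteq> ?W"
    using T T' unfolding image_comp[symmetric] by (intro image_mono; simp add: well_formed_def)+
  have e: "paired (linked ?V ?E) ((?l \<circ> ends T) \<circ> transposed) \<longleftrightarrow>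
      \<not> paired (linked ?V ?E) (?l \<circ> ends T)"
    using T unfolding comp_assoc L by (simp add: well_formed_def horizontal_def)
  have e': "paired (linked ?W ?F) ((?r \<circ> ends T') \<circ> transposed) \<longleftrightarrow>
      \<not> paired (linked ?W ?F) (?r \<circ> ends T')"
    using T' unfolding comp_assoc R by (simp add: well_formed_def horizontal_def)
  have pts: "pts (beside T T') = ?V \<union> ?W"
    and ends_eq: "ends (beside T T') = case_corner ((?l \<circ> ends T) NW) ((?r \<circ> ends T') NE)
      ((?l \<circ> ends T) SW) ((?r \<circ> ends T') SE)"
    by (simp_all add: beside_def relabel_def Let_def)
  have arcs: "state_arcs (beside T T') (joint_state A B) =
    insert ((?l \<circ> ends T) NE, (?r \<circ> ends T') NW) (insert ((?l \<circ> ends T) SE, (?r \<circ> ends T') SW) (?E \<union> ?F))"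
    by (simp add: state_arcs_beside)
  note g = glue[OF fin disj E F ends e e', folded pts arcs ends_eq, unfolded L R]
  show "horizontal (beside T T') (joint_state A B) \<longleftrightarrow> horizontal T A \<and> horizontal T' B"
    using g(1) by (simp add: horizontal_def)
  show "horizontal (flip (beside T T')) (joint_state A B) \<longleftrightarrow>
      \<not> (horizontal T A \<and> horizontal T' B)"
    using g(2) by (simp add: horizontal_def)
  show "loops (beside T T') (joint_state A B) =
      loops T A + loops T' B + (if horizontal T A \<or> horizontal T' B then 0 else 1)"
    using g(3)
    unfolding pieces_image[OF inj_even_odd(1)] pieces_image[OF inj_even_odd(2)]
      pieces_state[OF T] pieces_state[OF T'] loops_def[of "beside T T'"] horizontal_def
    by auto
qed

lemma all_states_beside:
  "(\<forall>C\<subseteq>crossings (beside T T'). P C) \<longleftrightarrow>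
    (\<forall>A\<subseteq>crossings T. \<forall>B\<subseteq>crossings T'. P (joint_state A B))"
proof -
  have "(\<forall>C\<in>Pow (crossings (beside T T')). P C) \<longleftrightarrow>
      (\<forall>(A, B)\<in>Pow (crossings T) \<times> Pow (crossings T'). P (joint_state A B))"
    unfolding crossings_beside bij_betw_imp_surj_on[OF bij_betw_joint_state, symmetric]
    by (simp add: case_prod_beta)
  then show ?thesis
    by (auto simp: Ball_def)
qed

lemma sum_states_beside:
  "(\<Sum>C\<in>Pow (crossings (beside T T')). F C) =
    (\<Sum>A\<in>Pow (crossings T). \<Sum>B\<in>Pow (crossings T'). F (joint_state A B))"
  using sum.reindex_bij_betw[OF bij_betw_joint_state[of "crossings T" "crossings T'"], of F]
  by (simp add: crossings_beside sum.cartesian_product case_prod_beta)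

lemma relabel_mem:
  assumes "well_formed T"
  shows "finite (pts (relabel f T))" "finite (crossings (relabel f T))"
    "ends (relabel f T) i \<in> pts (relabel f T)"
    "set_mset (arcs (relabel f T)) \<subseteq> pts (relabel f T) \<times> pts (relabel f T)"
    "\<forall>c\<in>crossings (relabel f T). range c \<subseteq> pts (relabel f T)"
proof -
  have T: "finite (pts T)" "finite (crossings T)" "set_mset (arcs T) \<subseteq> pts T \<times> pts T"
    "ends T i \<in> pts T" "\<And>c i. c \<in> crossings T \<Longrightarrow> c i \<in> pts T"
    using assms unfolding well_formed_def by (meson range_subsetD)+
  then show "finite (pts (relabel f T))" "finite (crossings (relabel f T))"
    "ends (relabel f T) i \<in> pts (relabel f T)"
    by (simp_all add: relabel_def)
  show "set_mset (arcs (relabel f T)) \<subseteq> pts (relabel f T) \<times> pts (relabel f T)"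
    using T(3) by (auto simp: relabel_def)
  show "\<forall>c\<in>crossings (relabel f T). range c \<subseteq> pts (relabel f T)"
    using T(5) by (auto simp: relabel_def)
qed

lemma well_formed_beside:
  assumes "well_formed T" "well_formed T'"
  shows "well_formed (beside T T')"
proof -
  have states: "\<forall>C\<subseteq>crossings (beside T T').
      horizontal (flip (beside T T')) C \<longleftrightarrow> \<not> horizontal (beside T T') C"
    unfolding all_states_beside using beside_state(1,2)[OF assms(1) _ assms(2)] by simp
  let ?L = "relabel (\<lambda>p. 2 * p) T" and ?R = "relabel (\<lambda>p. 2 * p + 1) T'"
  \<comment> \<open>The relabelled tangles stay folded, which keeps parity arithmetic out of the goals below.\<close>
  note mem = relabel_mem[OF assms(1), of "\<lambda>p. 2 * p"] relabel_mem[OF assms(2), of "\<lambda>p. 2 * p + 1"]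
  have beside: "pts (beside T T') = pts ?L \<union> pts ?R"
    "arcs (beside T T') = arcs ?L + arcs ?R + {#(ends ?L NE, ends ?R NW), (ends ?L SE, ends ?R SW)#}"
    "crossings (beside T T') = crossings ?L \<union> crossings ?R"
    "ends (beside T T') = case_corner (ends ?L NW) (ends ?R NE) (ends ?L SW) (ends ?R SE)"
    by (simp_all add: beside_def Let_def)
  have "range (ends (beside T T')) \<subseteq> pts (beside T T')"
    unfolding beside UNIV_corner using mem(3,8) by simp
  moreover have "set_mset (arcs (beside T T')) \<subseteq> pts (beside T T') \<times> pts (beside T T')"
    unfolding beside using mem(3,4,8,9) by auto
  moreover have "\<forall>c\<in>crossings (beside T T'). range c \<subseteq> pts (beside T T')"
    unfolding beside using mem(5,10) by blast
  moreover have "finite (pts (beside T T'))" "finite (crossings (beside T T'))"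
    unfolding beside using mem(1,2,6,7) by simp_all
  ultimately show ?thesis
    unfolding well_formed_def using states by blast
qed

lemma horizontal_part_beside:
  assumes "well_formed T" "well_formed T'"
  shows "horizontal_part (beside T T') = horizontal_part T * horizontal_part T'"
  unfolding horizontal_part_def[of "beside T T'"] sum_states_beside
  unfolding horizontal_part_def sum_product
  using beside_state[OF assms(1) _ assms(2)]
  by (intro sum.cong) (auto simp: power_add)

text \<open>
  The strands of the composite are vertical if those of at least one factor are; when both are, the
  strands facing each other close up to a loop, whence the factor \<open>X\<close>.
\<close>

lemma vertical_part_beside:
  assumes "well_formed T" "well_formed T'"
  shows "vertical_part (beside T T') =
    horizontal_part T * vertical_part T' + vertical_part T * horizontal_part T' +
    X * (vertical_part T * vertical_part T')"
  unfolding vertical_part_eq[OF well_formed_beside[OF assms]] sum_states_beside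
  unfolding vertical_part_eq[OF assms(1)] vertical_part_eq[OF assms(2)]
  unfolding horizontal_part_def sum_product sum_distrib_left[of X] sum.distrib[symmetric]
  using beside_state[OF assms(1) _ assms(2)]
  by (intro sum.cong) (auto simp: power_add)

lemma well_formed_above: "well_formed T \<Longrightarrow> well_formed T' \<Longrightarrow> well_formed (above T T')"
  by (simp add: above_eq_beside well_formed_flip well_formed_beside)

lemma horizontal_part_above:
  assumes "well_formed T" "well_formed T'"
  shows "horizontal_part (above T T') =
    vertical_part T * horizontal_part T' + horizontal_part T * vertical_part T' +
    X * (horizontal_part T * horizontal_part T')"
  using vertical_part_beside[OF assms[THEN well_formed_flip]]
  unfolding above_eq_beside flip_flip .

lemma vertical_part_above:
  assumes "well_formed T" "well_formed T'"
  shows "vertical_part (above T T') = vertical_part T * vertical_part T'"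
  using horizontal_part_beside[OF assms[THEN well_formed_flip]]
  unfolding above_eq_beside flip_flip .

section \<open>Closing a tangle\<close>

definition close :: "tangle \<Rightarrow> diagram" where
  "close T = \<lparr>pts = pts T, arcs = arcs T + {#(ends T NW, ends T NE), (ends T SW, ends T SE)#},
    crossings = crossings T\<rparr>"

lemma sinnet_eq_close: "sinnet n = close (overhand_row n)"
  by (simp add: sinnet_def close_def Let_def)

lemma overhand_knot_eq_close: "overhand_knot n = close (flip (overhand_row n))"
  by (simp add: overhand_knot_def close_def Let_def)

text \<open>
  Joining NW to NE and SW to SE closes each horizontal strand separately.  For vertical strands the
  first new arc merges them, and the second joins two ends of the same curve.
\<close>

lemma circles_close:
  assumes T: "well_formed T" "A \<subseteq> crossings T"
  shows "circles (state (close T) A) = loops T A + (if horizontal T A then 2 else 1)"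
proof -
  let ?V = "pts T" and ?E = "state_arcs T A" and ?e = "ends T"
  let ?E' = "insert (?e SW, ?e SE) ?E"
  have "state_arcs (close T) A = insert (?e NW, ?e NE) ?E'"
    by (auto simp: state_arcs_def close_def)
  then have c: "circles (state (close T) A) = pieces ?V (insert (?e NW, ?e NE) ?E')"
    using T circles_state[of "close T" A] by (simp add: close_def well_formed_def)
  have mem: "?e i \<in> ?V" "finite ?V" for i
    using T by (auto simp: well_formed_def)
  show ?thesis
  proof (cases "horizontal T A")
    case True
    then have "(?e SW, ?e SE) \<in> linked ?V ?E" "(?e NW, ?e NE) \<in> linked ?V ?E'"
      by (simp_all add: horizontal_def paired_def linked_insert mem)
    with True show ?thesis
      by (simp add: c pieces_insert_linked pieces_state[OF T])
  next
    case False
    then have "paired (linked ?V ?E) (?e \<circ> transposed)"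
      using T by (simp add: well_formed_def horizontal_def)
    then have "(?e SW, ?e SE) \<notin> linked ?V ?E" "(?e NW, ?e NE) \<in> linked ?V ?E'"
      by (simp_all add: paired_transposed_iff linked_insert mem)
    then have "pieces ?V ?E = Suc (pieces ?V (insert (?e NW, ?e NE) ?E'))"
      by (simp add: pieces_insert_linked pieces_insert_unlinked mem)
    with False show ?thesis
      by (simp add: c pieces_state[OF T])
  qed
qed

lemma generating_poly_close:
  assumes "well_formed T"
  shows "generating_poly (close T) = X ^ 2 * horizontal_part T + X * vertical_part T"
proof -
  have cr: "crossings (close T) = crossings T"
    by (simp add: close_def)
  show ?thesis
    unfolding generating_poly_def cr vertical_part_eq[OF assms]
    unfolding horizontal_part_def sum_distrib_left sum.distrib[symmetric]
    using circles_close[OF assms]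
    by (intro sum.cong refl) (auto simp: power_add mult.commute simp del: mult_pCons_left)
qed

section \<open>Overhand blocks and rows\<close>

lemma inj_four_points: "inj four_points"
  by (auto simp: inj_def four_points_def split: corner.splits)

lemma finite_four_points: "finite (range four_points)"
  by (simp add: UNIV_corner)

lemma four_points_strands:
  defines "h \<equiv> {(four_points NW, four_points NE), (four_points SW, four_points SE)}"
    and "v \<equiv> {(four_points NW, four_points SW), (four_points NE, four_points SE)}"
    and "V \<equiv> range four_points"
  shows "paired (linked V h) four_points" "paired (linked V v) (four_points \<circ> transposed)"
    "\<not> paired (linked V h) (four_points \<circ> transposed)" "\<not> paired (linked V v) four_points"
    "pieces V h = 2" "pieces V v = 2"
proof -
  have inj: "inj (four_points \<circ> transposed)"
    using inj_four_points transposed_transposed by (metis inj_compose injI)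
  note * = paired_strands[OF inj_four_points] paired_strands[OF inj, unfolded range_transposed]
  show h: "paired (linked V h) four_points" and v: "paired (linked V v) (four_points \<circ> transposed)"
    and "pieces V h = 2" "pieces V v = 2"
    using * by (simp_all add: h_def v_def V_def)
  show "\<not> paired (linked V h) (four_points \<circ> transposed)" "\<not> paired (linked V v) four_points"
    using h v unfolding paired_transposed_iff by (auto simp: paired_def all_corner)
qed

lemma horizontal_strands_parts:
  "well_formed horizontal_strands" "horizontal_part horizontal_strands = 1"
  "vertical_part horizontal_strands = 0"
proof -
  let ?T = horizontal_strands
  have T: "pts ?T = range four_points" "ends ?T = four_points" "crossings ?T = {}"
    "set_mset (arcs ?T) \<subseteq> range four_points \<times> range four_points"
    "state_arcs ?T {} = {(four_points NW, four_points NE), (four_points SW, four_points SE)}"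
    by (auto simp: horizontal_strands_def state_arcs_def)
  have state: "horizontal ?T {}" "\<not> horizontal (flip ?T) {}" "loops ?T {} = 0"
    by (simp_all add: horizontal_def loops_def T four_points_strands)
  show "well_formed ?T"
    by (simp add: well_formed_def T state finite_four_points)
  show "horizontal_part ?T = 1" "vertical_part ?T = 0"
    by (simp_all add: horizontal_part_def T state)
qed

lemma single_crossing_parts:
  "well_formed single_crossing" "horizontal_part single_crossing = 1"
  "vertical_part single_crossing = 1"
proof -
  let ?T = single_crossing
  have T: "pts ?T = range four_points" "ends ?T = four_points" "crossings ?T = {four_points}"
    "arcs ?T = {#}"
    "state_arcs ?T {} = {(four_points NW, four_points NE), (four_points SW, four_points SE)}"
    "state_arcs ?T {four_points} = {(four_points NW, four_points SW), (four_points NE, four_points SE)}"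
    by (simp_all add: single_crossing_def state_arcs_def split0_def split1_def)
  have state: "horizontal ?T {}" "\<not> horizontal (flip ?T) {}" "loops ?T {} = 0"
    "\<not> horizontal ?T {four_points}" "horizontal (flip ?T) {four_points}"
    "loops ?T {four_points} = 0"
    by (simp_all add: horizontal_def loops_def T four_points_strands)
  show "well_formed ?T"
    unfolding well_formed_def T subset_singleton_iff using state
    by (auto simp: finite_four_points)
  have "{} \<noteq> {four_points}"
    by simp
  then show "horizontal_part ?T = 1" "vertical_part ?T = 1"
    by (simp_all add: horizontal_part_def T state Pow_insert)
qed

lemma overhand_block_parts:
  "well_formed overhand_block" "horizontal_part overhand_block = X ^ 2 + 3 * X + 3"
  "vertical_part overhand_block = 1"
proof -
  \<comment> \<open>The left-hand side is what the stacking rule produces from three crossings with both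
    polynomials equal to 1.\<close>
  have ring: "1 + 1 + x * 1 + 1 + x * (1 + 1 + x * 1) = x ^ 2 + 3 * x + 3" for x :: "int poly"
    by (simp add: algebra_simps power2_eq_square)
  note parts = single_crossing_parts well_formed_above horizontal_part_above vertical_part_above
  show "well_formed overhand_block" "vertical_part overhand_block = 1"
    by (simp_all add: overhand_block_def parts)
  show "horizontal_part overhand_block = X ^ 2 + 3 * X + 3"
    unfolding overhand_block_def by (simp only: parts mult_1 ring)
qed

text \<open>
  The power \<open>(a H + V)^n\<close>, where \<open>V\<close> behaves like \<open>x\<close> times an idempotent.  The vertical polynomial is
  the quotient \<open>((x + a)^n - a^n) / x\<close>; it is stated multiplied by \<open>x\<close>, which is also the form
  in which it enters the closures.
\<close>

lemma overhand_row_parts: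
  defines "a \<equiv> X ^ 2 + 3 * X + 3"
  shows "well_formed (overhand_row n)" "horizontal_part (overhand_row n) = a ^ n"
    "X * vertical_part (overhand_row n) = (X + a) ^ n - a ^ n"
proof -
  \<comment> \<open>Written out as a coefficient list, the indeterminate would be multiplied out by the simplifier;
    it is therefore replaced by an opaque \<open>x\<close>.\<close>
  obtain x where x: "X = x" by simp
  have "well_formed (overhand_row n) \<and> horizontal_part (overhand_row n) = a ^ n \<and>
    x * vertical_part (overhand_row n) = (x + a) ^ n - a ^ n"
  proof (induction n rule: overhand_row.induct)
    case 1
    then show ?case
      by (simp add: horizontal_strands_parts)
  next
    case 2
    then show ?case
      by (simp add: overhand_block_parts a_def x)
  next
    case (3 n)
    let ?R = "overhand_row (Suc n)"
    have block: "well_formed overhand_block" "horizontal_part overhand_block = a"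
      "vertical_part overhand_block = 1"
      using overhand_block_parts by (simp_all add: a_def)
    have "x * vertical_part (beside ?R overhand_block) =
      x * horizontal_part ?R + (a + x) * (x * vertical_part ?R)"
      using 3 block by (simp add: vertical_part_beside x algebra_simps)
    also have "\<dots> = (x + a) ^ Suc (Suc n) - a ^ Suc (Suc n)"
      unfolding conjunct2[OF 3, THEN conjunct1] conjunct2[OF 3, THEN conjunct2]
      by (simp add: algebra_simps)
    finally show ?case
      using 3 block by (simp add: well_formed_beside horizontal_part_beside mult.commute)
  qed
  then show "well_formed (overhand_row n)" "horizontal_part (overhand_row n) = a ^ n"
    "X * vertical_part (overhand_row n) = (X + a) ^ n - a ^ n"
    by (simp_all only: x)
qed

section \<open>Generating polynomials of sinnets and overhand knots\<close>

lemma generating_poly_sinnet: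
  "generating_poly (sinnet n) =
    (X ^ 2 + 4 * X + 3) ^ n + (X ^ 2 - 1) * (X ^ 2 + 3 * X + 3) ^ n"
proof -
  have "X + (X ^ 2 + 3 * X + 3) = X ^ 2 + 4 * X + 3"
    by (simp add: numeral_poly)
  then show ?thesis
    unfolding sinnet_eq_close generating_poly_close[OF overhand_row_parts(1)]
      overhand_row_parts(2,3)
    by (simp only: algebra_simps)
qed

text \<open>Here the closing arcs join NW to SW and NE to SE, so \<open>h\<close> and \<open>v\<close> change places.\<close>

lemma generating_poly_overhand_knot:
  "generating_poly (overhand_knot n) = X * (X ^ 2 + 4 * X + 3) ^ n"
proof -
  have "X + (X ^ 2 + 3 * X + 3) = X ^ 2 + 4 * X + 3"
    by (simp add: numeral_poly)
  moreover have "generating_poly (overhand_knot n) =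
    X * (X * vertical_part (overhand_row n) + horizontal_part (overhand_row n))"
    unfolding overhand_knot_eq_close generating_poly_close[OF well_formed_flip[OF overhand_row_parts(1)]]
      flip_flip
    by (simp only: power2_eq_square algebra_simps)
  ultimately show ?thesis
    unfolding overhand_row_parts(2,3) by (simp only: diff_add_cancel)
qed

theorem theorem52:
  "(\<forall>n::nat. n \<ge> 1 \<longrightarrow>
      generating_poly (sinnet n) =
        (X ^ 2 + 3 * X + 3) * generating_poly (sinnet (n - 1))
        + generating_poly (overhand_knot (n - 1))) \<and>
   (\<forall>n::nat. generating_poly (sinnet n) =
        (X ^ 2 + 4 * X + 3) ^ n + (X ^ 2 - 1) * (X ^ 2 + 3 * X + 3) ^ n)"
proof (intro conjI allI impI)
  fix n :: nat
  assume "n \<ge> 1"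
  then obtain m where n: "n = Suc m"
    by (cases n) auto
  have recurrence: "(x ^ 2 + 4 * x + 3) ^ Suc m + (x ^ 2 - 1) * (x ^ 2 + 3 * x + 3) ^ Suc m =
    (x ^ 2 + 3 * x + 3) * ((x ^ 2 + 4 * x + 3) ^ m + (x ^ 2 - 1) * (x ^ 2 + 3 * x + 3) ^ m) +
    x * (x ^ 2 + 4 * x + 3) ^ m" for x :: "int poly"
    by (simp add: algebra_simps)
  show "generating_poly (sinnet n) =
      (X ^ 2 + 3 * X + 3) * generating_poly (sinnet (n - 1)) + generating_poly (overhand_knot (n - 1))"
    unfolding generating_poly_sinnet generating_poly_overhand_knot n diff_Suc_1 by (rule recurrence)
qed (rule generating_poly_sinnet)

end
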